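(* Let $(s_i)_{i\in\mathbb{N}}$ be any sequence of points in $D$. Let $\Phi:\Theta\to\mathbb{R}^q$ with $q\in\mathbb{N}$ and let $\theta_0\in\Theta$. If $\Phi(\theta_0)$ is non-microergodic, then there does not exist a sequence of functions $\hat{\Phi}_n:\mathbb{R}^n\to\mathbb{R}^q$, $n\in\mathbb{N}$, such that, for any $\theta\in\Theta$, if $\xi$ has covariance function $k_\theta$ then $\hat{\Phi}_n(\xi(s_1),\ldots,\xi(s_n))$ converges to $\Phi(\theta)$ in probability as $n\to\infty$.
   Context: $\mathbb{N}$ is the set of positive integers. $D\subset\mathbb{R}^d$ is a compact set. $\Theta\subset\mathbb{R}^p$, and $\{k_\theta;\theta\in\Theta\}$ is a family of functions $k_\theta:\mathbb{R}^d\to\mathbb{R}$ that are symmetric ($k_\theta(u)=k_\theta(-u)$) and positive definite, meaning that for all $m\in\mathbb{N}$ and $u_1,\ldots,u_m\in\mathbb{R}^d$ the matrix $[k_\theta(u_i-u_j)]_{i,j=1,\ldots,m}$ is positive semi-definite. $\xi$ is a Gaussian process on $\mathbb{R}^d$ with mean function zero; saying that $\xi$ has (stationary) covariance function $k_\theta$ means $\mathrm{cov}(\xi(u),\xi(v))=k_\theta(u-v)$ for all $u,v\in\mathbb{R}^d$. For $\theta\in\Theta$, $\mathcal{M}_\theta$ denotes the probability measure on the set of functions from $D$ to $\mathbb{R}$, endowed with the cylindrical sigma-algebra, that is the law of (the restriction to $D$ of) $\xi$ when $\xi$ has covariance function $k_\theta$. Two measures $\mathcal{M}_{\theta_1}$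 and $\mathcal{M}_{\theta_2}$ are equivalent if, for every measurable set $A$ of functions, $\mathcal{M}_{\theta_1}(A)=0$ if and only if $\mathcal{M}_{\theta_2}(A)=0$. For $\Phi:\Theta\to\mathbb{R}^q$, $\Phi(\theta_0)$ is called non-microergodic if there exists $\theta_1\in\Theta$ such that $\Phi(\theta_1)\neq\Phi(\theta_0)$ and the measures $\mathcal{M}_{\theta_1}$ and $\mathcal{M}_{\theta_0}$ are equivalent. *)

theory Defs
  imports "HOL-Probability.Probability"
begin

definition psd_matrix :: "nat \<Rightarrow> (nat \<Rightarrow> nat \<Rightarrow> real) \<Rightarrow> bool" where
  "psd_matrix m A \<longleftrightarrow>
     (\<forall>i\<in>{1..m}. \<forall>j\<in>{1..m}. A i j = A j i) \<and>
     (\<forall>c :: nat \<Rightarrow> real. 0 \<le> (\<Sum>i=1..m. \<Sum>j=1..m. c i * A i j * c j))"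

definition symmetric_fun :: "('a :: ab_group_add \<Rightarrow> real) \<Rightarrow> bool" where
  "symmetric_fun k \<longleftrightarrow> (\<forall>u. k u = k (- u))"

definition positive_definite_fun :: "('a :: ab_group_add \<Rightarrow> real) \<Rightarrow> bool" where
  "positive_definite_fun k \<longleftrightarrow>
     (\<forall>m\<ge>1. \<forall>u :: nat \<Rightarrow> 'a. psd_matrix m (\<lambda>i j. k (u i - u j)))"

text \<open>
  The library's normal density is only a probability density for positive standard deviation.
  Since covariance matrices may be singular, the point masses are included here.
\<close>

definition gaussian_measure :: "real \<Rightarrow> real \<Rightarrow> real measure" where
  "gaussian_measure m \<sigma> =
     (if \<sigma> = 0 then return borel m else density lborel (\<lambda>x. ennreal (normal_density m \<sigma> x)))"

definition gaussian_rv :: "'w measure \<Rightarrow> ('w \<Rightarrow> real) \<Rightarrow> bool" where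
  "gaussian_rv M X \<longleftrightarrow>
     X \<in> borel_measurable M \<and> (\<exists>m \<sigma>. 0 \<le> \<sigma> \<and> distr M borel X = gaussian_measure m \<sigma>)"

definition gaussian_process :: "'w measure \<Rightarrow> ('a \<Rightarrow> 'w \<Rightarrow> real) \<Rightarrow> bool" where
  "gaussian_process M \<xi> \<longleftrightarrow>
     prob_space M \<and> (\<forall>u. \<xi> u \<in> borel_measurable M) \<and>
     (\<forall>I c. finite I \<longrightarrow> gaussian_rv M (\<lambda>\<omega>. \<Sum>u\<in>I. c u * \<xi> u \<omega>))"

definition cov :: "'w measure \<Rightarrow> ('w \<Rightarrow> real) \<Rightarrow> ('w \<Rightarrow> real) \<Rightarrow> real" where
  "cov M X Y = integral\<^sup>L M (\<lambda>\<omega>. (X \<omega> - integral\<^sup>L M X) * (Y \<omega> - integral\<^sup>L M Y))"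

definition centered_gp ::
  "'w measure \<Rightarrow> ('a :: ab_group_add \<Rightarrow> 'w \<Rightarrow> real) \<Rightarrow> ('a \<Rightarrow> real) \<Rightarrow> bool" where
  "centered_gp M \<xi> k \<longleftrightarrow>
     gaussian_process M \<xi> \<and> (\<forall>u. integral\<^sup>L M (\<xi> u) = 0) \<and>
     (\<forall>u v. cov M (\<xi> u) (\<xi> v) = k (u - v))"

text \<open>
  Functions from \<open>D\<close> to the reals are represented by their extensional versions, and the product
  sigma-algebra on them is the cylindrical one.
\<close>

definition process_law :: "'a set \<Rightarrow> 'w measure \<Rightarrow> ('a \<Rightarrow> 'w \<Rightarrow> real) \<Rightarrow> ('a \<Rightarrow> real) measure" where
  "process_law D M \<xi> = distr M (Pi\<^sub>M D (\<lambda>_. borel)) (\<lambda>\<omega>. \<lambda>u\<in>D. \<xi> u \<omega>)"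

text \<open>
  A law is determined by the covariance function. As one cannot quantify over types, processes are
  taken on probability spaces whose sample space type is that of all paths. This is no restriction:
  a process on any probability space has a version with the same law of this kind, namely the
  coordinate process under its path law.
\<close>

definition is_gp_law :: "'a :: ab_group_add set \<Rightarrow> ('a \<Rightarrow> real) \<Rightarrow> ('a \<Rightarrow> real) measure \<Rightarrow> bool" where
  "is_gp_law D k \<mu> \<longleftrightarrow>
     (\<exists>(M :: ('a \<Rightarrow> real) measure) \<xi>. centered_gp M \<xi> k \<and> \<mu> = process_law D M \<xi>)"

definition equivalent_measures :: "'b measure \<Rightarrow> 'b measure \<Rightarrow> bool" where
  "equivalent_measures \<mu> \<nu> \<longleftrightarrow>
     sets \<mu> = sets \<nu> \<and> (\<forall>A\<in>sets \<mu>. emeasure \<mu> A = 0 \<longleftrightarrow> emeasure \<nu> A = 0)"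

definition non_microergodic ::
  "'a :: ab_group_add set \<Rightarrow> 't set \<Rightarrow> ('t \<Rightarrow> 'a \<Rightarrow> real) \<Rightarrow> ('t \<Rightarrow> 'b) \<Rightarrow> 't \<Rightarrow> bool" where
  "non_microergodic D \<Theta> k \<Phi> \<theta>0 \<longleftrightarrow>
     (\<exists>\<theta>1\<in>\<Theta>. \<Phi> \<theta>1 \<noteq> \<Phi> \<theta>0 \<and>
       (\<exists>\<mu>1 \<mu>0. is_gp_law D (k \<theta>1) \<mu>1 \<and> is_gp_law D (k \<theta>0) \<mu>0 \<and> equivalent_measures \<mu>1 \<mu>0))"

text \<open>
  Measurability of the \<open>X n\<close> is part of the notion. Without it the measures below could be those of
  non-measurable sets, which are zero by convention.
\<close>

definition converges_in_probability ::
  "'w measure \<Rightarrow> (nat \<Rightarrow> 'w \<Rightarrow> 'b :: metric_space) \<Rightarrow> 'b \<Rightarrow> bool" where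
  "converges_in_probability M X c \<longleftrightarrow>
     (\<forall>n\<ge>1. X n \<in> borel_measurable M) \<and>
     (\<forall>\<epsilon>>0. (\<lambda>n. measure M {\<omega> \<in> space M. \<epsilon> < dist (X n \<omega>) c}) \<longlonglongrightarrow> 0)"

end

theory Submission
  imports Defs
begin

text \<open>
  The estimators are random variables on the path space, so under equivalent laws a sequence of events
  with vanishing probability for one law has vanishing probability for the other (Borel-Cantelli along
  a fast subsequence). The estimator would then converge in probability to two different limits under
  the same law.
\<close>

lemma measure_tendsto_0_absolutely_continuous:
  assumes "finite_measure \<mu>" "finite_measure \<nu>"
    and ac: "absolutely_continuous \<mu> \<nu>" and sets: "sets \<nu> = sets \<mu>"
    and B: "\<And>n. B n \<in> sets \<mu>"
    and lim: "(\<lambda>n. measure \<mu> (B n)) \<longlonglongrightarrow> 0"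
  shows "(\<lambda>n. measure \<nu> (B n)) \<longlonglongrightarrow> 0"
proof (rule ccontr)
  interpret \<mu>: finite_measure \<mu> by fact
  interpret \<nu>: finite_measure \<nu> by fact
  assume "\<not> ?thesis"
  then obtain e where e: "e > 0" and inf: "\<And>N. \<exists>n\<ge>N. e \<le> measure \<nu> (B n)"
    unfolding LIMSEQ_iff by (auto simp: not_less)
  \<comment> \<open>The hypothesis \<open>ac\<close> speaks of null sets only, so small values of
    \<open>\<mu>\<close> have to be condensed into a single null set. Powers of \<open>1/2\<close>
    make the chosen measures summable, which is all that Borel-Cantelli asks of the indices
    \<open>r j\<close>; they may repeat or go back.\<close>
  have "\<exists>n. measure \<mu> (B n) < (1/2) ^ j \<and> e \<le> measure \<nu> (B n)" for j :: nat
  proof -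
    have "\<forall>\<^sub>F n in sequentially. measure \<mu> (B n) < (1/2) ^ j"
      using lim by (rule order_tendstoD) simp
    then show ?thesis
      using inf unfolding eventually_sequentially by meson
  qed
  then obtain r where r: "\<And>j. measure \<mu> (B (r j)) < (1/2) ^ j" "\<And>j. e \<le> measure \<nu> (B (r j))"
    by metis
  \<comment> \<open>These tail unions decrease to the limsup, so continuity of \<open>\<nu>\<close>
    from above computes its measure. As \<open>U i\<close> contains \<open>B (r i)\<close>, that
    limit is at least \<open>e\<close>, whereas the limsup is null.\<close>
  define U where "U i = (\<Union>j\<in>{i..}. B (r j))" for i
  have U: "U i \<in> sets \<mu>" for i
    unfolding U_def using B by auto
  have "summable (\<lambda>j. measure \<mu> (B (r j)))"
    by (rule summable_comparison_test'[OF summable_geometric[of "1/2::real"], of 0])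
       (use r(1) in \<open>auto intro: less_imp_le\<close>)
  then have "limsup (\<lambda>j. B (r j)) \<in> null_sets \<mu>"
    using B by (intro borel_cantelli_limsup1) (auto simp: \<mu>.emeasure_finite less_top[symmetric])
  moreover have "limsup (\<lambda>j. B (r j)) = (\<Inter>i. U i)"
    unfolding U_def limsup_INF_SUP by simp
  ultimately have "(\<Inter>i. U i) \<in> null_sets \<nu>"
    using ac unfolding absolutely_continuous_def by auto
  moreover have "(\<lambda>i. measure \<nu> (U i)) \<longlonglongrightarrow> measure \<nu> (\<Inter>i. U i)"
  proof (rule \<nu>.finite_Lim_measure_decseq)
    show "range U \<subseteq> sets \<nu>" using U sets by auto
    show "decseq U" unfolding U_def by (intro antimonoI UN_mono) auto
  qed
  moreover have "e \<le> measure \<nu> (U i)" for i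
    using r(2)[of i] \<nu>.finite_measure_mono[of "B (r i)" "U i"] U sets
    by (force simp: U_def)
  ultimately have "e \<le> 0"
    by (metis LIMSEQ_le_const measure_eq_0_null_sets)
  with e show False by simp
qed

text \<open>The index set is \<open>UNIV\<close>, not \<open>D\<close>: the law then has the type
  over which the theorem quantifies its probability spaces, and can itself be taken as
  \<open>M\<close> there.\<close>

definition path_law :: "'w measure \<Rightarrow> ('a \<Rightarrow> 'w \<Rightarrow> real) \<Rightarrow> ('a \<Rightarrow> real) measure" where
  "path_law M \<xi> = distr M (Pi\<^sub>M UNIV (\<lambda>_. borel)) (\<lambda>\<omega> u. \<xi> u \<omega>)"

lemma measurable_path:
  assumes "\<And>u. \<xi> u \<in> borel_measurable M"
  shows "(\<lambda>\<omega> u. \<xi> u \<omega>) \<in> M \<rightarrow>\<^sub>M Pi\<^sub>M UNIV (\<lambda>_. borel)"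
  using assms by (intro measurable_PiM_single') auto

text \<open>Mean, covariance and the laws of finite linear combinations depend on the distribution
  alone, so each passes through \<open>distr\<close> by a change of variables. The coordinate
  process is wanted because measurability of an estimator after composition with
  \<open>\<xi>\<close> on \<open>M\<close> need not give measurability in the path; under
  \<open>path_law\<close> the two are the same.\<close>

lemma centered_gp_path_law:
  assumes "centered_gp M \<xi> k"
  shows "centered_gp (path_law M \<xi>) (\<lambda>u f. f u) k"
proof -
  from assms have gp: "prob_space M" "\<And>u. \<xi> u \<in> borel_measurable M"
    "\<And>I c. finite I \<Longrightarrow> gaussian_rv M (\<lambda>\<omega>. \<Sum>u\<in>I. c u * \<xi> u \<omega>)"
    and mean: "\<And>u. integral\<^sup>L M (\<xi> u) = 0" and cov: "\<And>u v. cov M (\<xi> u) (\<xi> v) = k (u - v)"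
    unfolding centered_gp_def gaussian_process_def by auto
  note path [measurable] = measurable_path[OF gp(2)]
  have mean': "integral\<^sup>L (path_law M \<xi>) (\<lambda>f. f u) = 0" for u
    unfolding path_law_def using mean[of u] by (subst integral_distr) auto
  have "cov (path_law M \<xi>) (\<lambda>f. f u) (\<lambda>f. f v) = cov M (\<xi> u) (\<xi> v)" for u v
    unfolding cov_def mean mean' unfolding path_law_def by (subst integral_distr) auto
  moreover have "gaussian_rv (path_law M \<xi>) (\<lambda>f. \<Sum>u\<in>I. c u * f u)" if "finite I" for I c
    using gp(3)[OF that, of c] unfolding gaussian_rv_def path_law_def
    by (auto simp: distr_distr comp_def)
  moreover have "prob_space (path_law M \<xi>)"
    unfolding path_law_def by (rule prob_space.prob_space_distr[OF gp(1) path])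
  ultimately show ?thesis
    unfolding centered_gp_def gaussian_process_def using mean' cov
    by (auto simp: path_law_def)
qed

lemma process_law_eq_distr_path_law:
  assumes "\<And>u. \<xi> u \<in> borel_measurable M"
  shows "process_law D M \<xi> = distr (path_law M \<xi>) (Pi\<^sub>M D (\<lambda>_. borel)) (\<lambda>f. restrict f D)"
  unfolding process_law_def path_law_def
  by (subst distr_distr) (auto simp: comp_def intro!: measurable_path assms measurable_restrict_subset)

text \<open>
  The estimators need not be Borel functions on their own. Extending a function on \<open>D\<close> by zero
  transfers the measurability required on the full path space to functions on \<open>D\<close>.
\<close>

lemma converges_in_probability_process_law:
  fixes g :: "nat \<Rightarrow> (nat \<Rightarrow> real) \<Rightarrow> 'b :: {metric_space, second_countable_topology}"
  assumes meas: "\<And>u. \<xi> u \<in> borel_measurable M" and s: "\<And>i. i \<ge> 1 \<Longrightarrow> s i \<in> D"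
    and conv: "converges_in_probability (path_law M \<xi>) (\<lambda>n f. g n (\<lambda>i\<in>{1..n}. f (s i))) c"
  shows "converges_in_probability (process_law D M \<xi>) (\<lambda>n f. g n (\<lambda>i\<in>{1..n}. f (s i))) c"
proof -
  let ?X = "\<lambda>n f. g n (\<lambda>i\<in>{1..n}. f (s i))"
  let ?P = "Pi\<^sub>M D (\<lambda>_. borel :: real measure)"
  have X: "?X n \<in> borel_measurable (Pi\<^sub>M UNIV (\<lambda>_. borel))" if "n \<ge> 1" for n
    using conv that unfolding converges_in_probability_def path_law_def by simp
  \<comment> \<open>The estimator reads a path only at \<open>s 1\<close>, ..., \<open>s n\<close>,
    all in \<open>D\<close>, so neither restricting nor extending the path changes its
    value.\<close>
  have res: "?X n (restrict f D) = ?X n f" for n f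
    using s by (intro arg_cong[of _ _ "g n"]) auto
  have ext: "(\<lambda>f u. if u \<in> D then f u else 0) \<in> ?P \<rightarrow>\<^sub>M Pi\<^sub>M UNIV (\<lambda>_. borel)"
  proof (intro measurable_PiM_single')
    show "(\<lambda>f. if u \<in> D then f u else 0) \<in> borel_measurable ?P" for u
      by (cases "u \<in> D") auto
  qed auto
  have XD: "?X n \<in> borel_measurable ?P" if "n \<ge> 1" for n
  proof -
    have "?X n (\<lambda>u. if u \<in> D then f u else 0) = ?X n f" for f
      using s by (intro arg_cong[of _ _ "g n"]) auto
    then show ?thesis
      using measurable_compose[OF ext X[OF that]] by simp
  qed
  have restr: "(\<lambda>f. restrict f D) \<in> path_law M \<xi> \<rightarrow>\<^sub>M ?P"
    unfolding path_law_def by (auto intro: measurable_restrict_subset)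
  have eq: "measure (process_law D M \<xi>) {f \<in> space (process_law D M \<xi>). \<epsilon> < dist (?X n f) c}
      = measure (path_law M \<xi>) {f \<in> space (path_law M \<xi>). \<epsilon> < dist (?X n f) c}"
    if "n \<ge> 1" for n \<epsilon>
  proof -
    note XD[OF that, measurable]
    have "{f \<in> space ?P. \<epsilon> < dist (?X n f) c} \<in> sets ?P"
      by measurable
    moreover have "(\<lambda>f. restrict f D) -` {f \<in> space ?P. \<epsilon> < dist (?X n f) c} \<inter> space (path_law M \<xi>)
        = {f \<in> space (path_law M \<xi>). \<epsilon> < dist (?X n f) c}"
      using res by (auto simp: space_PiM)
    ultimately show ?thesis
      unfolding process_law_eq_distr_path_law[of \<xi>, OF meas] using restr
      by (simp add: measure_distr)
  qed
  show ?thesis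
    unfolding converges_in_probability_def
  proof (intro conjI allI impI)
    fix n :: nat assume "n \<ge> 1"
    then show "?X n \<in> borel_measurable (process_law D M \<xi>)"
      using XD unfolding process_law_def by simp
  next
    \<comment> \<open>The equality \<open>eq\<close> starts at index 1, because nothing is known
      about measurability at index 0; the limit ignores that term.\<close>
    fix \<epsilon> :: real assume "\<epsilon> > 0"
    then have "(\<lambda>n. measure (path_law M \<xi>) {f \<in> space (path_law M \<xi>). \<epsilon> < dist (?X n f) c}) \<longlonglongrightarrow> 0"
      using conv unfolding converges_in_probability_def by blast
    then show "(\<lambda>n. measure (process_law D M \<xi>) {f \<in> space (process_law D M \<xi>). \<epsilon> < dist (?X n f) c}) \<longlonglongrightarrow> 0"
      by (rule Lim_transform_eventually) (rule eventually_sequentiallyI[of 1], rule eq[symmetric])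
  qed
qed

text \<open>Deviation from \<open>a\<close> has vanishing probability under \<open>\<mu>\<close>,
  hence also under \<open>\<nu>\<close>. By the triangle inequality every outcome deviates from
  \<open>a\<close> or from \<open>b\<close>, so the two probabilities under \<open>\<nu>\<close> sum
  to at least 1 and cannot both vanish.\<close>

lemma converges_in_probability_equivalent_unique:
  fixes X :: "nat \<Rightarrow> 'w \<Rightarrow> 'b :: {metric_space, second_countable_topology}"
  assumes "prob_space \<mu>" "prob_space \<nu>" and equiv: "equivalent_measures \<mu> \<nu>"
    and a: "converges_in_probability \<mu> X a" and b: "converges_in_probability \<nu> X b"
  shows "a = b"
proof (rule ccontr)
  assume "a \<noteq> b"
  \<comment> \<open>Any positive value below half the distance would do: the events use strict
    inequality, so at exactly half a midpoint could escape both.\<close>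
  define \<epsilon> where "\<epsilon> = dist a b / 3"
  have \<epsilon>: "\<epsilon> > 0" using \<open>a \<noteq> b\<close> by (simp add: \<epsilon>_def)
  interpret \<mu>: prob_space \<mu> by fact
  interpret \<nu>: prob_space \<nu> by fact
  have sets: "sets \<nu> = sets \<mu>" and space: "space \<nu> = space \<mu>"
    and ac: "absolutely_continuous \<mu> \<nu>"
    using equiv sets_eq_imp_space_eq[of \<nu> \<mu>]
    by (auto simp: equivalent_measures_def absolutely_continuous_def null_sets_def)
  \<comment> \<open>The shift by \<open>Suc\<close> keeps to indices at least 1, where the
    \<open>X n\<close> are known to be measurable.\<close>
  define A where "A n = {\<omega> \<in> space \<mu>. \<epsilon> < dist (X (Suc n) \<omega>) a}" for n
  define B where "B n = {\<omega> \<in> space \<mu>. \<epsilon> < dist (X (Suc n) \<omega>) b}" for n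
  have X [measurable]: "X (Suc n) \<in> borel_measurable \<mu>" for n
    using a by (simp add: converges_in_probability_def)
  have AB: "A n \<in> sets \<mu>" "B n \<in> sets \<mu>" for n
    unfolding A_def B_def by measurable
  have "(\<lambda>n. measure \<mu> (A n)) \<longlonglongrightarrow> 0" "(\<lambda>n. measure \<nu> (B n)) \<longlonglongrightarrow> 0"
    using a b \<epsilon> unfolding converges_in_probability_def A_def B_def space
    by (auto intro: LIMSEQ_Suc)
  moreover from this(1) have "(\<lambda>n. measure \<nu> (A n)) \<longlonglongrightarrow> 0"
    using AB(1) by (intro measure_tendsto_0_absolutely_continuous[OF \<mu>.finite_measure_axioms \<nu>.finite_measure_axioms ac sets])
  ultimately have "(\<lambda>n. measure \<nu> (A n) + measure \<nu> (B n)) \<longlonglongrightarrow> 0"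
    using tendsto_add by fastforce
  moreover have "1 \<le> measure \<nu> (A n) + measure \<nu> (B n)" for n
  proof -
    have "space \<mu> \<subseteq> A n \<union> B n"
    proof
      fix \<omega> assume "\<omega> \<in> space \<mu>"
      moreover have "dist a b \<le> dist (X (Suc n) \<omega>) a + dist (X (Suc n) \<omega>) b"
        by (rule dist_triangle3)
      then have "\<epsilon> < dist (X (Suc n) \<omega>) a \<or> \<epsilon> < dist (X (Suc n) \<omega>) b"
        using \<epsilon> \<epsilon>_def by linarith
      ultimately show "\<omega> \<in> A n \<union> B n"
        unfolding A_def B_def by blast
    qed
    then have "measure \<nu> (space \<nu>) \<le> measure \<nu> (A n \<union> B n)"
      using AB sets space by (intro \<nu>.finite_measure_mono) auto
    also have "\<dots> \<le> measure \<nu> (A n) + measure \<nu> (B n)"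
      using AB sets by (intro measure_Un_le) auto
    finally show ?thesis by (simp add: \<nu>.prob_space)
  qed
  ultimately have "(1::real) \<le> 0"
    by (meson LIMSEQ_le_const)
  then show False by simp
qed

theorem lemma8:
  fixes D :: "(real ^ 'd) set"
    and \<Theta> :: "(real ^ 'p) set"
    and k :: "real ^ 'p \<Rightarrow> real ^ 'd \<Rightarrow> real"
    and s :: "nat \<Rightarrow> real ^ 'd"
    and \<Phi> :: "real ^ 'p \<Rightarrow> real ^ 'q"
    and \<theta>0 :: "real ^ 'p"
  assumes "compact D"
    and "\<And>\<theta>. \<theta> \<in> \<Theta> \<Longrightarrow> symmetric_fun (k \<theta>)"
    and "\<And>\<theta>. \<theta> \<in> \<Theta> \<Longrightarrow> positive_definite_fun (k \<theta>)"
    and "\<And>i. i \<ge> 1 \<Longrightarrow> s i \<in> D"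
    and "\<theta>0 \<in> \<Theta>"
    and "non_microergodic D \<Theta> k \<Phi> \<theta>0"
  shows "\<not> (\<exists>\<Phi>hat :: nat \<Rightarrow> (nat \<Rightarrow> real) \<Rightarrow> real ^ 'q.
            \<forall>\<theta>\<in>\<Theta>. \<forall>(M :: (real ^ 'd \<Rightarrow> real) measure) \<xi>.
              centered_gp M \<xi> (k \<theta>) \<longrightarrow>
              converges_in_probability M (\<lambda>n \<omega>. \<Phi>hat n (\<lambda>i\<in>{1..n}. \<xi> (s i) \<omega>)) (\<Phi> \<theta>))"
proof
  assume "\<exists>\<Phi>hat :: nat \<Rightarrow> (nat \<Rightarrow> real) \<Rightarrow> real ^ 'q.
            \<forall>\<theta>\<in>\<Theta>. \<forall>(M :: (real ^ 'd \<Rightarrow> real) measure) \<xi>.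
              centered_gp M \<xi> (k \<theta>) \<longrightarrow>
              converges_in_probability M (\<lambda>n \<omega>. \<Phi>hat n (\<lambda>i\<in>{1..n}. \<xi> (s i) \<omega>)) (\<Phi> \<theta>)"
  then obtain \<Phi>hat :: "nat \<Rightarrow> (nat \<Rightarrow> real) \<Rightarrow> real ^ 'q" where
    est: "\<And>\<theta> (M :: (real ^ 'd \<Rightarrow> real) measure) \<xi>. \<theta> \<in> \<Theta> \<Longrightarrow> centered_gp M \<xi> (k \<theta>) \<Longrightarrow>
      converges_in_probability M (\<lambda>n \<omega>. \<Phi>hat n (\<lambda>i\<in>{1..n}. \<xi> (s i) \<omega>)) (\<Phi> \<theta>)"
    by blast
  have law: "prob_space \<mu> \<and>
      converges_in_probability \<mu> (\<lambda>n f. \<Phi>hat n (\<lambda>i\<in>{1..n}. f (s i))) (\<Phi> \<theta>)"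
    if \<theta>: "\<theta> \<in> \<Theta>" and "is_gp_law D (k \<theta>) \<mu>" for \<theta> \<mu>
  proof -
    obtain M :: "(real ^ 'd \<Rightarrow> real) measure" and \<xi>
      where gp: "centered_gp M \<xi> (k \<theta>)" and \<mu>: "\<mu> = process_law D M \<xi>"
      using \<open>is_gp_law D (k \<theta>) \<mu>\<close> unfolding is_gp_law_def by blast
    from gp have M: "prob_space M" and meas: "\<And>u. \<xi> u \<in> borel_measurable M"
      unfolding centered_gp_def gaussian_process_def by auto
    have "prob_space \<mu>"
      unfolding \<mu> process_law_def
      by (intro prob_space.prob_space_distr M measurable_restrict meas)
    \<comment> \<open>Here \<open>est\<close> is applied to the coordinate process under
      \<open>path_law M \<xi>\<close> instead of \<open>\<xi>\<close> itself, which makes the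
      estimator a measurable function of the path before passing to \<open>D\<close>.\<close>
    moreover have "converges_in_probability \<mu> (\<lambda>n f. \<Phi>hat n (\<lambda>i\<in>{1..n}. f (s i))) (\<Phi> \<theta>)"
      unfolding \<mu> by (intro converges_in_probability_process_law meas assms(4)
        est[OF \<theta> centered_gp_path_law[OF gp]])
    ultimately show ?thesis by blast
  qed
  obtain \<theta>1 \<mu>1 \<mu>0 where "\<theta>1 \<in> \<Theta>" "\<Phi> \<theta>1 \<noteq> \<Phi> \<theta>0"
    "is_gp_law D (k \<theta>1) \<mu>1" "is_gp_law D (k \<theta>0) \<mu>0" "equivalent_measures \<mu>1 \<mu>0"
    using assms(6) unfolding non_microergodic_def by blast
  \<comment> \<open>The same functions of the path converge under both laws, to
    \<open>\<Phi> \<theta>1\<close> and to \<open>\<Phi> \<theta>0\<close>, so uniqueness of the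
    limit applies.\<close>
  then show False
    using law[of \<theta>1 \<mu>1] law[of \<theta>0 \<mu>0] assms(5) converges_in_probability_equivalent_unique by blast
qed

end
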